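(* In $\mathbf{F}_2^\mu$, the reduction relations $\leadsto_{\beta\mu\tau o} = \leadsto_\beta\cup\leadsto_\mu\cup\leadsto_\tau\cup\leadsto_o$ and $\leadsto_{h\tau o} = \leadsto_h\cup\leadsto_\tau\cup\leadsto_o$ on evidence are confluent, and $\leadsto_\tau$ is strongly normalizing.
   Context: Evidence of $\mathbf{F}_2^\mu$: $e ::= \alpha \mid \kappa \mid \lambda\alpha.e \mid e\,e' \mid \mu\alpha.e \mid e\,T \mid \lambda x.e$, where $\alpha$ are evidence variables, $\kappa$ evidence constants, $x$ type variables and $T$ types ($T ::= F \mid x \mid \lambda x.T \mid \forall x{:}K.T \mid T\,T' \mid T \Rightarrow T'$). On types, $\to_o$ is the compatible closure of $(\lambda x.T)\,T' \to_o [T'/x]T$. Head reduction contexts: $\mathcal{H} ::= \bullet \mid \mathcal{H}\,e \mid \lambda\alpha.\mathcal{H} \mid \lambda x.\mathcal{H}$. General reduction contexts: $\mathcal{C} ::= \bullet \mid \mathcal{C}\,e \mid \mathcal{C}\,T \mid \lambda\alpha.\mathcal{C} \mid \lambda x.\mathcal{C} \mid e\,\mathcal{C} \mid \mu\alpha.\mathcal{C}$. Reductions: $\mathcal{H}[\mu\alpha.e] \leadsto_h \mathcal{H}[[\mu\alpha.e/\alpha]e]$; $\mathcal{H}[(\lambda\alpha.e)\,e'] \leadsto_h \mathcal{H}[[e'/\alpha]e]$; $\mathcal{C}[(\lambda x.e)\,T] \leadsto_\tau \mathcal{C}[[T/x]e]$; $\mathcal{C}[\mu\alpha.e]\leadsto_\mu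 \mathcal{C}[[\mu\alpha.e/\alpha]e]$; $\mathcal{C}[(\lambda\alpha.e)\,e'] \leadsto_\beta \mathcal{C}[[e'/\alpha]e]$; $\mathcal{C}[T] \leadsto_o \mathcal{C}[T']$ whenever $T\to_o T'$. *)

theory Defs
  imports Main "HOL-Library.Confluence"
begin

text \<open>
  Terms are taken modulo alpha-equivalence by means of de Bruijn indices. Evidence variables and
  type variables are indexed separately: the index of an evidence variable counts the enclosing
  evidence binders (lambda and mu) only, the index of a type variable the enclosing type-variable
  binders only. The type constants \<^typ>\<open>'f\<close>, the kinds \<^typ>\<open>'k\<close> and the evidence
  constants \<^typ>\<open>'c\<close> are parameters; kinds occur only as annotations, which reduction ignores.
\<close>

datatype ('f, 'k) ty =
    TyConst 'f
  | TyVar nat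
  | TyLam "('f, 'k) ty"
  | TyAll 'k "('f, 'k) ty"
  | TyApp "('f, 'k) ty" "('f, 'k) ty"
  | TyImp "('f, 'k) ty" "('f, 'k) ty"

datatype ('c, 'f, 'k) ev =
    Var nat
  | Const 'c
  | Lam "('c, 'f, 'k) ev"
  | App "('c, 'f, 'k) ev" "('c, 'f, 'k) ev"
  | Mu "('c, 'f, 'k) ev"
  | TApp "('c, 'f, 'k) ev" "('f, 'k) ty"
  | TLam "('c, 'f, 'k) ev"


text \<open>
  Capture-avoiding simultaneous substitution. A renaming or substitution is pushed under a binder
  by \<open>up\<close>, which fixes index 0 and weakens all other images.
\<close>

definition up_ren :: "(nat \<Rightarrow> nat) \<Rightarrow> nat \<Rightarrow> nat" where
  "up_ren \<rho> = case_nat 0 (\<lambda>i. Suc (\<rho> i))"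

primrec ren_ty :: "(nat \<Rightarrow> nat) \<Rightarrow> ('f, 'k) ty \<Rightarrow> ('f, 'k) ty" where
  "ren_ty \<rho> (TyConst F) = TyConst F"
| "ren_ty \<rho> (TyVar i) = TyVar (\<rho> i)"
| "ren_ty \<rho> (TyLam T) = TyLam (ren_ty (up_ren \<rho>) T)"
| "ren_ty \<rho> (TyAll K T) = TyAll K (ren_ty (up_ren \<rho>) T)"
| "ren_ty \<rho> (TyApp T T') = TyApp (ren_ty \<rho> T) (ren_ty \<rho> T')"
| "ren_ty \<rho> (TyImp T T') = TyImp (ren_ty \<rho> T) (ren_ty \<rho> T')"

definition up_ty :: "(nat \<Rightarrow> ('f, 'k) ty) \<Rightarrow> nat \<Rightarrow> ('f, 'k) ty" where
  "up_ty \<sigma> = case_nat (TyVar 0) (\<lambda>i. ren_ty Suc (\<sigma> i))"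

primrec subst_ty :: "(nat \<Rightarrow> ('f, 'k) ty) \<Rightarrow> ('f, 'k) ty \<Rightarrow> ('f, 'k) ty" where
  "subst_ty \<sigma> (TyConst F) = TyConst F"
| "subst_ty \<sigma> (TyVar i) = \<sigma> i"
| "subst_ty \<sigma> (TyLam T) = TyLam (subst_ty (up_ty \<sigma>) T)"
| "subst_ty \<sigma> (TyAll K T) = TyAll K (subst_ty (up_ty \<sigma>) T)"
| "subst_ty \<sigma> (TyApp T T') = TyApp (subst_ty \<sigma> T) (subst_ty \<sigma> T')"
| "subst_ty \<sigma> (TyImp T T') = TyImp (subst_ty \<sigma> T) (subst_ty \<sigma> T')"

primrec ren_ev_ty :: "(nat \<Rightarrow> nat) \<Rightarrow> ('c, 'f, 'k) ev \<Rightarrow> ('c, 'f, 'k) ev" where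
  "ren_ev_ty \<rho> (Var i) = Var i"
| "ren_ev_ty \<rho> (Const c) = Const c"
| "ren_ev_ty \<rho> (Lam e) = Lam (ren_ev_ty \<rho> e)"
| "ren_ev_ty \<rho> (App e e') = App (ren_ev_ty \<rho> e) (ren_ev_ty \<rho> e')"
| "ren_ev_ty \<rho> (Mu e) = Mu (ren_ev_ty \<rho> e)"
| "ren_ev_ty \<rho> (TApp e T) = TApp (ren_ev_ty \<rho> e) (ren_ty \<rho> T)"
| "ren_ev_ty \<rho> (TLam e) = TLam (ren_ev_ty (up_ren \<rho>) e)"

primrec subst_ev_ty :: "(nat \<Rightarrow> ('f, 'k) ty) \<Rightarrow> ('c, 'f, 'k) ev \<Rightarrow> ('c, 'f, 'k) ev" where
  "subst_ev_ty \<sigma> (Var i) = Var i"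
| "subst_ev_ty \<sigma> (Const c) = Const c"
| "subst_ev_ty \<sigma> (Lam e) = Lam (subst_ev_ty \<sigma> e)"
| "subst_ev_ty \<sigma> (App e e') = App (subst_ev_ty \<sigma> e) (subst_ev_ty \<sigma> e')"
| "subst_ev_ty \<sigma> (Mu e) = Mu (subst_ev_ty \<sigma> e)"
| "subst_ev_ty \<sigma> (TApp e T) = TApp (subst_ev_ty \<sigma> e) (subst_ty \<sigma> T)"
| "subst_ev_ty \<sigma> (TLam e) = TLam (subst_ev_ty (up_ty \<sigma>) e)"

primrec ren_ev :: "(nat \<Rightarrow> nat) \<Rightarrow> ('c, 'f, 'k) ev \<Rightarrow> ('c, 'f, 'k) ev" where
  "ren_ev \<rho> (Var i) = Var (\<rho> i)"
| "ren_ev \<rho> (Const c) = Const c"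
| "ren_ev \<rho> (Lam e) = Lam (ren_ev (up_ren \<rho>) e)"
| "ren_ev \<rho> (App e e') = App (ren_ev \<rho> e) (ren_ev \<rho> e')"
| "ren_ev \<rho> (Mu e) = Mu (ren_ev (up_ren \<rho>) e)"
| "ren_ev \<rho> (TApp e T) = TApp (ren_ev \<rho> e) T"
| "ren_ev \<rho> (TLam e) = TLam (ren_ev \<rho> e)"

definition up_ev :: "(nat \<Rightarrow> ('c, 'f, 'k) ev) \<Rightarrow> nat \<Rightarrow> ('c, 'f, 'k) ev" where
  "up_ev \<sigma> = case_nat (Var 0) (\<lambda>i. ren_ev Suc (\<sigma> i))"

text \<open>Under \<^const>\<open>TLam\<close> it is the type variables of the substituted evidence that are weakened.\<close>

primrec subst_ev :: "(nat \<Rightarrow> ('c, 'f, 'k) ev) \<Rightarrow> ('c, 'f, 'k) ev \<Rightarrow> ('c, 'f, 'k) ev" where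
  "subst_ev \<sigma> (Var i) = \<sigma> i"
| "subst_ev \<sigma> (Const c) = Const c"
| "subst_ev \<sigma> (Lam e) = Lam (subst_ev (up_ev \<sigma>) e)"
| "subst_ev \<sigma> (App e e') = App (subst_ev \<sigma> e) (subst_ev \<sigma> e')"
| "subst_ev \<sigma> (Mu e) = Mu (subst_ev (up_ev \<sigma>) e)"
| "subst_ev \<sigma> (TApp e T) = TApp (subst_ev \<sigma> e) T"
| "subst_ev \<sigma> (TLam e) = TLam (subst_ev (\<lambda>i. ren_ev_ty Suc (\<sigma> i)) e)"

text \<open>
  Substitution for the variable bound by the binder just removed: index 0 is replaced and all
  other indices drop by one.
\<close>

definition inst_ty :: "('f, 'k) ty \<Rightarrow> ('f, 'k) ty \<Rightarrow> ('f, 'k) ty" where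
  "inst_ty T' T = subst_ty (case_nat T' TyVar) T"

definition inst_ev_ty :: "('f, 'k) ty \<Rightarrow> ('c, 'f, 'k) ev \<Rightarrow> ('c, 'f, 'k) ev" where
  "inst_ev_ty T e = subst_ev_ty (case_nat T TyVar) e"

definition inst_ev :: "('c, 'f, 'k) ev \<Rightarrow> ('c, 'f, 'k) ev \<Rightarrow> ('c, 'f, 'k) ev" where
  "inst_ev e' e = subst_ev (case_nat e' Var) e"


inductive red_ty :: "('f, 'k) ty \<Rightarrow> ('f, 'k) ty \<Rightarrow> bool" where
  beta: "red_ty (TyApp (TyLam T) T') (inst_ty T' T)"
| lam: "red_ty T T' \<Longrightarrow> red_ty (TyLam T) (TyLam T')"
| all: "red_ty T T' \<Longrightarrow> red_ty (TyAll K T) (TyAll K T')"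
| appL: "red_ty T T' \<Longrightarrow> red_ty (TyApp T U) (TyApp T' U)"
| appR: "red_ty U U' \<Longrightarrow> red_ty (TyApp T U) (TyApp T U')"
| impL: "red_ty T T' \<Longrightarrow> red_ty (TyImp T U) (TyImp T' U)"
| impR: "red_ty U U' \<Longrightarrow> red_ty (TyImp T U) (TyImp T U')"

text \<open>
  Filling a hole may capture variables, so no index is shifted. Head contexts do not extend to
  the function part of a type application, nor under mu.
\<close>

datatype ('c, 'f, 'k) hctx =
    HHole
  | HApp "('c, 'f, 'k) hctx" "('c, 'f, 'k) ev"
  | HLam "('c, 'f, 'k) hctx"
  | HTLam "('c, 'f, 'k) hctx"

primrec hfill :: "('c, 'f, 'k) hctx \<Rightarrow> ('c, 'f, 'k) ev \<Rightarrow> ('c, 'f, 'k) ev" where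
  "hfill HHole e = e"
| "hfill (HApp H e') e = App (hfill H e) e'"
| "hfill (HLam H) e = Lam (hfill H e)"
| "hfill (HTLam H) e = TLam (hfill H e)"

datatype ('c, 'f, 'k) ctx =
    Hole
  | CAppL "('c, 'f, 'k) ctx" "('c, 'f, 'k) ev"
  | CTApp "('c, 'f, 'k) ctx" "('f, 'k) ty"
  | CLam "('c, 'f, 'k) ctx"
  | CTLam "('c, 'f, 'k) ctx"
  | CAppR "('c, 'f, 'k) ev" "('c, 'f, 'k) ctx"
  | CMu "('c, 'f, 'k) ctx"

primrec fill :: "('c, 'f, 'k) ctx \<Rightarrow> ('c, 'f, 'k) ev \<Rightarrow> ('c, 'f, 'k) ev" where
  "fill Hole e = e"
| "fill (CAppL C e') e = App (fill C e) e'"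
| "fill (CTApp C T) e = TApp (fill C e) T"
| "fill (CLam C) e = Lam (fill C e)"
| "fill (CTLam C) e = TLam (fill C e)"
| "fill (CAppR e' C) e = App e' (fill C e)"
| "fill (CMu C) e = Mu (fill C e)"

inductive red_h :: "('c, 'f, 'k) ev \<Rightarrow> ('c, 'f, 'k) ev \<Rightarrow> bool" where
  mu: "red_h (hfill H (Mu e)) (hfill H (inst_ev (Mu e) e))"
| beta: "red_h (hfill H (App (Lam e) e')) (hfill H (inst_ev e' e))"

inductive red_tau :: "('c, 'f, 'k) ev \<Rightarrow> ('c, 'f, 'k) ev \<Rightarrow> bool" where
  "red_tau (fill C (TApp (TLam e) T)) (fill C (inst_ev_ty T e))"

inductive red_mu :: "('c, 'f, 'k) ev \<Rightarrow> ('c, 'f, 'k) ev \<Rightarrow> bool" where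
  "red_mu (fill C (Mu e)) (fill C (inst_ev (Mu e) e))"

inductive red_beta :: "('c, 'f, 'k) ev \<Rightarrow> ('c, 'f, 'k) ev \<Rightarrow> bool" where
  "red_beta (fill C (App (Lam e) e')) (fill C (inst_ev e' e))"

text \<open>
  A type occurs in evidence only as the argument of a type application, so a general context
  whose hole is filled by a type is a general context around \<open>TApp e \<bullet>\<close>.
\<close>

inductive red_o :: "('c, 'f, 'k) ev \<Rightarrow> ('c, 'f, 'k) ev \<Rightarrow> bool" where
  "red_ty T T' \<Longrightarrow> red_o (fill C (TApp e T)) (fill C (TApp e T'))"

definition red_beta_mu_tau_o :: "('c, 'f, 'k) ev \<Rightarrow> ('c, 'f, 'k) ev \<Rightarrow> bool" where
  "red_beta_mu_tau_o e e' \<longleftrightarrow> red_beta e e' \<or> red_mu e e' \<or> red_tau e e' \<or> red_o e e'"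

definition red_h_tau_o :: "('c, 'f, 'k) ev \<Rightarrow> ('c, 'f, 'k) ev \<Rightarrow> bool" where
  "red_h_tau_o e e' \<longleftrightarrow> red_h e e' \<or> red_tau e e' \<or> red_o e e'"

text \<open>
  Well-foundedness is taken of the converse because \<^const>\<open>wfp\<close> excludes infinite descending
  chains, with the smaller element on the left.
\<close>

definition strongly_normalizing :: "('a \<Rightarrow> 'a \<Rightarrow> bool) \<Rightarrow> bool" where
  "strongly_normalizing r \<longleftrightarrow> wfp (r\<inverse>\<inverse>)"

end

theory Submission
  imports Defs
begin

text \<open>
  Full reduction is treated by the Tait--Martin-Loef technique: parallel reduction, in which any set
  of redexes is contracted simultaneously, has the diamond property and the same reflexive
  transitive closure. The same relation without the beta and mu rules takes care of tau and o.
  A head redex is never erased or duplicated by a parallel tau-o step, because head contexts do not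
  pass through type applications or into arguments, and two head steps from a common source can be
  joined by at most one head step on each side. Hence the union of single head steps (or none) and
  parallel tau-o steps again has the diamond property. Finally, a tau step removes exactly one type
  abstraction, since substituted types contain no evidence.
\<close>

section \<open>Substitution calculus\<close>

lemma up_ren_simps [simp]: "up_ren \<rho> 0 = 0" "up_ren \<rho> (Suc i) = Suc (\<rho> i)"
  by (simp_all add: up_ren_def)

lemma up_ty_simps [simp]: "up_ty \<sigma> 0 = TyVar 0" "up_ty \<sigma> (Suc i) = ren_ty Suc (\<sigma> i)"
  by (simp_all add: up_ty_def)

lemma up_ev_simps [simp]: "up_ev \<theta> 0 = Var 0" "up_ev \<theta> (Suc i) = ren_ev Suc (\<theta> i)"
  by (simp_all add: up_ev_def)

text \<open>Every lifting \<open>up_ren\<close>, \<open>up_ty\<close>, \<open>up_ev\<close> and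
  every \<open>case_nat\<close> substitution is defined by cases on the index, so the equations
  between them are proved on 0 and successors.\<close>

lemma nat_funI: "f 0 = g 0 \<Longrightarrow> (\<And>i. f (Suc i) = g (Suc i)) \<Longrightarrow> f = g"
  by (rule ext, case_tac x) auto

lemma up_ren_comp: "(\<lambda>i. up_ren \<rho> (up_ren \<rho>' i)) = up_ren (\<lambda>i. \<rho> (\<rho>' i))"
  by (rule nat_funI) simp_all

lemma up_ty_TyVar_ren: "up_ty (\<lambda>i. TyVar (\<rho> i)) = (\<lambda>i. TyVar (up_ren \<rho> i))"
  by (rule nat_funI) simp_all

lemma ren_ty_conv_subst: "ren_ty \<rho> T = subst_ty (\<lambda>i. TyVar (\<rho> i)) T"
  by (induction T arbitrary: \<rho>) (simp_all add: up_ty_TyVar_ren)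

lemma up_ty_TyVar: "up_ty TyVar = TyVar"
  by (rule nat_funI) simp_all

lemma subst_ty_TyVar [simp]: "subst_ty TyVar T = T"
  by (induction T) (simp_all add: up_ty_TyVar)

text \<open>First rung of the usual ladder for composition: renaming after renaming, substitution
  after renaming, renaming after substitution, substitution after substitution. Passing a binder at
  a later rung uses earlier rungs, since lifting a substitution renames its images.\<close>

lemma ren_ren_ty: "ren_ty \<rho> (ren_ty \<rho>' T) = ren_ty (\<lambda>i. \<rho> (\<rho>' i)) T"
  by (induction T arbitrary: \<rho> \<rho>') (simp_all add: up_ren_comp)

lemma up_ty_up_ren: "(\<lambda>i. up_ty \<sigma> (up_ren \<rho> i)) = up_ty (\<lambda>i. \<sigma> (\<rho> i))"
  by (rule nat_funI) simp_all

lemma subst_ren_ty: "subst_ty \<sigma> (ren_ty \<rho> T) = subst_ty (\<lambda>i. \<sigma> (\<rho> i)) T"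
  by (induction T arbitrary: \<sigma> \<rho>) (simp_all add: up_ty_up_ren)

lemma ren_up_ty: "(\<lambda>i. ren_ty (up_ren \<rho>) (up_ty \<sigma> i)) = up_ty (\<lambda>i. ren_ty \<rho> (\<sigma> i))"
  by (rule nat_funI) (simp_all add: ren_ren_ty)

lemma ren_subst_ty: "ren_ty \<rho> (subst_ty \<sigma> T) = subst_ty (\<lambda>i. ren_ty \<rho> (\<sigma> i)) T"
  by (induction T arbitrary: \<sigma> \<rho>) (simp_all add: ren_up_ty)

lemma subst_up_ty: "(\<lambda>i. subst_ty (up_ty \<tau>) (up_ty \<sigma> i)) = up_ty (\<lambda>i. subst_ty \<tau> (\<sigma> i))"
  by (rule nat_funI) (simp_all add: ren_subst_ty subst_ren_ty)

lemma subst_subst_ty: "subst_ty \<tau> (subst_ty \<sigma> T) = subst_ty (\<lambda>i. subst_ty \<tau> (\<sigma> i)) T"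
  by (induction T arbitrary: \<sigma> \<tau>) (simp_all add: subst_up_ty)

text \<open>The substitution lemma stated on index functions, so that it serves for instantiation
  both in types and in evidence.\<close>

lemma inst_up_ty:
  "(\<lambda>i. subst_ty (case_nat (subst_ty \<sigma> T) TyVar) (up_ty \<sigma> i))
    = (\<lambda>i. subst_ty \<sigma> (case_nat T TyVar i))"
  by (rule nat_funI) (simp_all add: subst_ren_ty)

lemma subst_inst_ty: "subst_ty \<sigma> (inst_ty T' T) = inst_ty (subst_ty \<sigma> T') (subst_ty (up_ty \<sigma>) T)"
  by (simp add: inst_ty_def subst_subst_ty inst_up_ty)

section \<open>Substitution of type variables in evidence\<close>

lemma ren_ev_ty_conv_subst: "ren_ev_ty \<rho> e = subst_ev_ty (\<lambda>i. TyVar (\<rho> i)) e"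
  by (induction e arbitrary: \<rho>) (simp_all add: up_ty_TyVar_ren ren_ty_conv_subst)

lemma subst_ev_ty_TyVar [simp]: "subst_ev_ty TyVar e = e"
  by (induction e) (simp_all add: up_ty_TyVar)

lemma subst_subst_ev_ty:
  "subst_ev_ty \<tau> (subst_ev_ty \<sigma> e) = subst_ev_ty (\<lambda>i. subst_ty \<tau> (\<sigma> i)) e"
  by (induction e arbitrary: \<sigma> \<tau>) (simp_all add: subst_subst_ty subst_up_ty)

lemma subst_ren_ev_ty: "subst_ev_ty \<sigma> (ren_ev_ty \<rho> e) = subst_ev_ty (\<lambda>i. \<sigma> (\<rho> i)) e"
  by (simp add: ren_ev_ty_conv_subst subst_subst_ev_ty)

lemma ren_subst_ev_ty: "ren_ev_ty \<rho> (subst_ev_ty \<sigma> e) = subst_ev_ty (\<lambda>i. ren_ty \<rho> (\<sigma> i)) e"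
  by (simp add: ren_ev_ty_conv_subst subst_subst_ev_ty ren_ty_conv_subst)

lemma subst_inst_ev_ty:
  "subst_ev_ty \<sigma> (inst_ev_ty T e) = inst_ev_ty (subst_ty \<sigma> T) (subst_ev_ty (up_ty \<sigma>) e)"
  by (simp add: inst_ev_ty_def subst_subst_ev_ty inst_up_ty)

text \<open>The two kinds of variables are indexed separately, so the operations do not
  interfere.\<close>

lemma subst_ev_ty_ren_ev: "subst_ev_ty \<sigma> (ren_ev \<rho> e) = ren_ev \<rho> (subst_ev_ty \<sigma> e)"
  by (induction e arbitrary: \<sigma> \<rho>) simp_all

lemma subst_ev_ty_up_ev:
  "(\<lambda>i. subst_ev_ty \<sigma> (up_ev \<theta> i)) = up_ev (\<lambda>i. subst_ev_ty \<sigma> (\<theta> i))"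
  by (rule nat_funI) (simp_all add: subst_ev_ty_ren_ev)

text \<open>The images of \<theta> may contain types, so they receive \<sigma> as well. Under
  \<open>TLam\<close>, weakening an image and then applying the lifted \<sigma> agrees with applying
  \<sigma> and then weakening.\<close>

lemma subst_ev_ty_subst_ev:
  "subst_ev_ty \<sigma> (subst_ev \<theta> e) = subst_ev (\<lambda>i. subst_ev_ty \<sigma> (\<theta> i)) (subst_ev_ty \<sigma> e)"
  by (induction e arbitrary: \<sigma> \<theta>)
    (simp_all add: subst_ev_ty_up_ev subst_ren_ev_ty ren_subst_ev_ty)

lemma subst_ev_ty_inst_ev:
  "subst_ev_ty \<sigma> (inst_ev e' e) = inst_ev (subst_ev_ty \<sigma> e') (subst_ev_ty \<sigma> e)"
proof -
  have "(\<lambda>i. subst_ev_ty \<sigma> (case_nat e' Var i)) = case_nat (subst_ev_ty \<sigma> e') Var"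
    by (rule nat_funI) simp_all
  then show ?thesis by (simp add: inst_ev_def subst_ev_ty_subst_ev)
qed

text \<open>Instantiating type index 0 cancels the weakening that the images underwent beneath
  \<open>TLam\<close>, so \<theta> is recovered on the outside.\<close>

lemma subst_ev_inst_ev_ty:
  "subst_ev \<theta> (inst_ev_ty T e) = inst_ev_ty T (subst_ev (\<lambda>i. ren_ev_ty Suc (\<theta> i)) e)"
  by (simp add: inst_ev_ty_def subst_ev_ty_subst_ev subst_ren_ev_ty)

section \<open>Substitution of evidence variables\<close>

lemma up_ev_Var: "up_ev Var = Var"
  by (rule nat_funI) simp_all

lemma subst_ev_Var [simp]: "subst_ev Var e = e"
  by (induction e) (simp_all add: up_ev_Var)

lemma ren_ren_ev: "ren_ev \<rho> (ren_ev \<rho>' e) = ren_ev (\<lambda>i. \<rho> (\<rho>' i)) e"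
  by (induction e arbitrary: \<rho> \<rho>') (simp_all add: up_ren_comp)

lemma up_ev_up_ren: "(\<lambda>i. up_ev \<theta> (up_ren \<rho> i)) = up_ev (\<lambda>i. \<theta> (\<rho> i))"
  by (rule nat_funI) simp_all

lemma subst_ren_ev: "subst_ev \<theta> (ren_ev \<rho> e) = subst_ev (\<lambda>i. \<theta> (\<rho> i)) e"
  by (induction e arbitrary: \<theta> \<rho>) (simp_all add: up_ev_up_ren)

lemma ren_up_ev: "(\<lambda>i. ren_ev (up_ren \<rho>) (up_ev \<theta> i)) = up_ev (\<lambda>i. ren_ev \<rho> (\<theta> i))"
  by (rule nat_funI) (simp_all add: ren_ren_ev)

lemma ren_ev_ren_ev_ty: "ren_ev \<rho> (ren_ev_ty \<rho>' e) = ren_ev_ty \<rho>' (ren_ev \<rho> e)"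
  by (simp add: ren_ev_ty_conv_subst subst_ev_ty_ren_ev)

lemma ren_subst_ev: "ren_ev \<rho> (subst_ev \<theta> e) = subst_ev (\<lambda>i. ren_ev \<rho> (\<theta> i)) e"
  by (induction e arbitrary: \<theta> \<rho>) (simp_all add: ren_up_ev ren_ev_ren_ev_ty)

lemma subst_up_ev: "(\<lambda>i. subst_ev (up_ev \<eta>) (up_ev \<theta> i)) = up_ev (\<lambda>i. subst_ev \<eta> (\<theta> i))"
  by (rule nat_funI) (simp_all add: ren_subst_ev subst_ren_ev)

text \<open>The \<open>TLam\<close> case needs type weakening to commute with evidence substitution;
  reading weakening as a type substitution makes \<open>subst_ev_ty_subst_ev\<close>
  applicable.\<close>

lemma subst_subst_ev: "subst_ev \<eta> (subst_ev \<theta> e) = subst_ev (\<lambda>i. subst_ev \<eta> (\<theta> i)) e"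
  by (induction e arbitrary: \<theta> \<eta>)
    (simp_all add: subst_up_ev ren_ev_ty_conv_subst subst_ev_ty_subst_ev)

lemma subst_inst_ev: "subst_ev \<theta> (inst_ev e' e) = inst_ev (subst_ev \<theta> e') (subst_ev (up_ev \<theta>) e)"
proof -
  have "(\<lambda>i. subst_ev (case_nat (subst_ev \<theta> e') Var) (up_ev \<theta> i))
      = (\<lambda>i. subst_ev \<theta> (case_nat e' Var i))"
    by (rule nat_funI) (simp_all add: subst_ren_ev)
  then show ?thesis by (simp add: inst_ev_def subst_subst_ev)
qed

text \<open>Needed for closure of parallel reduction under renaming, which must precede closure
  under substitution because lifted substitutions rename their images.\<close>

lemma ren_inst_ty: "ren_ty \<rho> (inst_ty T' T) = inst_ty (ren_ty \<rho> T') (ren_ty (up_ren \<rho>) T)"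
proof -
  have "(\<lambda>i. ren_ty \<rho> (case_nat T' TyVar i)) = (\<lambda>i. case_nat (ren_ty \<rho> T') TyVar (up_ren \<rho> i))"
    by (rule nat_funI) simp_all
  then show ?thesis by (simp add: inst_ty_def ren_subst_ty subst_ren_ty)
qed

lemma ren_inst_ev: "ren_ev \<rho> (inst_ev e' e) = inst_ev (ren_ev \<rho> e') (ren_ev (up_ren \<rho>) e)"
proof -
  have "(\<lambda>i. ren_ev \<rho> (case_nat e' Var i)) = (\<lambda>i. case_nat (ren_ev \<rho> e') Var (up_ren \<rho> i))"
    by (rule nat_funI) simp_all
  then show ?thesis by (simp add: inst_ev_def ren_subst_ev subst_ren_ev)
qed

lemma ren_ev_inst_ev_ty: "ren_ev \<rho> (inst_ev_ty T e) = inst_ev_ty T (ren_ev \<rho> e)"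
  by (simp add: inst_ev_ty_def subst_ev_ty_ren_ev)


section \<open>Parallel reduction\<close>

inductive par_ty :: "('f, 'k) ty \<Rightarrow> ('f, 'k) ty \<Rightarrow> bool" where
  const: "par_ty (TyConst F) (TyConst F)"
| var: "par_ty (TyVar i) (TyVar i)"
| lam: "par_ty T T' \<Longrightarrow> par_ty (TyLam T) (TyLam T')"
| all: "par_ty T T' \<Longrightarrow> par_ty (TyAll K T) (TyAll K T')"
| app: "par_ty T T' \<Longrightarrow> par_ty U U' \<Longrightarrow> par_ty (TyApp T U) (TyApp T' U')"
| imp: "par_ty T T' \<Longrightarrow> par_ty U U' \<Longrightarrow> par_ty (TyImp T U) (TyImp T' U')"
| beta: "par_ty T T' \<Longrightarrow> par_ty U U' \<Longrightarrow> par_ty (TyApp (TyLam T) U) (inst_ty U' T')"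

inductive_cases par_ty_ConstE: "par_ty (TyConst F) U"
inductive_cases par_ty_VarE: "par_ty (TyVar i) U"
inductive_cases par_ty_LamE: "par_ty (TyLam T) U"
inductive_cases par_ty_AllE: "par_ty (TyAll K T) U"
inductive_cases par_ty_AppE: "par_ty (TyApp T T') U"
inductive_cases par_ty_ImpE: "par_ty (TyImp T T') U"

lemma par_ty_refl [simp, intro]: "par_ty T T"
  by (induction T) (auto intro: par_ty.intros)

lemma par_ty_ren: "par_ty T T' \<Longrightarrow> par_ty (ren_ty \<rho> T) (ren_ty \<rho> T')"
  by (induction arbitrary: \<rho> rule: par_ty.induct) (auto simp: ren_inst_ty intro: par_ty.intros)

lemma par_ty_up: "(\<And>i. par_ty (\<sigma> i) (\<sigma>' i)) \<Longrightarrow> par_ty (up_ty \<sigma> i) (up_ty \<sigma>' i)"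
  by (cases i) (auto intro: par_ty_ren)

text \<open>The substitution reduces along with the term: contracting a redex places a reduced
  argument into a reduced body. The beta case rests on \<open>subst_inst_ty\<close>.\<close>

lemma par_ty_subst:
  "par_ty T T' \<Longrightarrow> (\<And>i. par_ty (\<sigma> i) (\<sigma>' i)) \<Longrightarrow> par_ty (subst_ty \<sigma> T) (subst_ty \<sigma>' T')"
  by (induction arbitrary: \<sigma> \<sigma>' rule: par_ty.induct)
    (simp_all add: subst_inst_ty par_ty.intros par_ty_up)

lemma par_ty_case_nat: "par_ty T T' \<Longrightarrow> par_ty (case_nat T TyVar i) (case_nat T' TyVar i)"
  by (cases i) auto

lemma par_ty_inst: "par_ty T T' \<Longrightarrow> par_ty U U' \<Longrightarrow> par_ty (inst_ty U T) (inst_ty U' T')"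
  unfolding inst_ty_def by (intro par_ty_subst par_ty_case_nat)

lemma par_ty_diamond: "par_ty T U \<Longrightarrow> par_ty T V \<Longrightarrow> \<exists>W. par_ty U W \<and> par_ty V W"
proof (induction arbitrary: V rule: par_ty.induct)
  case (lam T T')
  from lam.prems show ?case by (rule par_ty_LamE) (metis lam.IH par_ty.lam)
next
  case (all T T' K)
  from all.prems show ?case by (rule par_ty_AllE) (metis all.IH par_ty.all)
next
  case (imp T T' U U')
  from imp.prems show ?case by (rule par_ty_ImpE) (metis imp.IH par_ty.imp)
next
  case (app T T' U U')
  from app.prems show ?case
  proof (rule par_ty_AppE)
    fix T2 U2 assume "V = TyApp T2 U2" "par_ty T T2" "par_ty U U2"
    then show ?case by (metis app.IH par_ty.app)
  next
    fix S S2 U2 assume *: "T = TyLam S" "V = inst_ty U2 S2" "par_ty S S2" "par_ty U U2"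
    from * app.hyps obtain S1 where S1: "T' = TyLam S1" by (auto elim: par_ty_LamE)
    \<comment> \<open>The induction hypothesis speaks of the whole abstraction, not of its body. The
      competing step in the body is therefore lifted under \<open>TyLam\<close>, joined there, and
      the join is peeled again.\<close>
    obtain W where "par_ty (TyLam S1) W" "par_ty (TyLam S2) W"
      using app.IH(1)[of "TyLam S2"] * S1 by (auto intro: par_ty.lam)
    then obtain S3 where "par_ty S1 S3" "par_ty S2 S3" by (auto elim!: par_ty_LamE)
    moreover obtain U3 where "par_ty U' U3" "par_ty U2 U3" using app.IH(2) * by blast
    ultimately show ?case using * S1 by (blast intro: par_ty.beta par_ty_inst)
  qed
next
  case (beta T T' U U')
  from beta.prems show ?case
  proof (rule par_ty_AppE)
    fix T2 U2 assume *: "V = TyApp T2 U2" "par_ty (TyLam T) T2" "par_ty U U2"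
    then show ?case by (metis beta.IH par_ty.beta par_ty_LamE par_ty_inst)
  next
    fix S S2 U2 assume "TyLam T = TyLam S" "V = inst_ty U2 S2" "par_ty S S2" "par_ty U U2"
    then show ?case by (metis beta.IH par_ty_inst ty.inject(3))
  qed
qed (auto elim: par_ty_ConstE par_ty_VarE)

section \<open>Parallel reduction of evidence\<close>

text \<open>The flag \<open>b\<close> enables the beta and mu rules, so one development covers both
  full reduction (\<open>par True\<close>) and its tau-o fragment (\<open>par False\<close>). In
  \<open>unfold\<close> the body and its inserted copy are the same reduct
  \<open>e'\<close>.\<close>

inductive par :: "bool \<Rightarrow> ('c, 'f, 'k) ev \<Rightarrow> ('c, 'f, 'k) ev \<Rightarrow> bool" for b where
  var: "par b (Var i) (Var i)"
| const: "par b (Const c) (Const c)"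
| lam: "par b e e' \<Longrightarrow> par b (Lam e) (Lam e')"
| app: "par b e e' \<Longrightarrow> par b d d' \<Longrightarrow> par b (App e d) (App e' d')"
| mu: "par b e e' \<Longrightarrow> par b (Mu e) (Mu e')"
| tapp: "par b e e' \<Longrightarrow> par_ty T T' \<Longrightarrow> par b (TApp e T) (TApp e' T')"
| tlam: "par b e e' \<Longrightarrow> par b (TLam e) (TLam e')"
| tau: "par b e e' \<Longrightarrow> par_ty T T' \<Longrightarrow> par b (TApp (TLam e) T) (inst_ev_ty T' e')"
| beta: "b \<Longrightarrow> par b e e' \<Longrightarrow> par b d d' \<Longrightarrow> par b (App (Lam e) d) (inst_ev d' e')"
| unfold: "b \<Longrightarrow> par b e e' \<Longrightarrow> par b (Mu e) (inst_ev (Mu e') e')"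

inductive_cases par_VarE: "par b (Var i) u"
inductive_cases par_ConstE: "par b (Const c) u"
inductive_cases par_LamE: "par b (Lam e) u"
inductive_cases par_TAppE: "par b (TApp e T) u"
inductive_cases par_TLamE: "par b (TLam e) u"

lemma par_AppE:
  assumes "par b (App e d) v"
  obtains (app) e' d' where "v = App e' d'" "par b e e'" "par b d d'"
    | (beta) f f' d' where "e = Lam f" "v = inst_ev d' f'" "b" "par b f f'" "par b d d'"
  using assms by (cases rule: par.cases) blast+

lemma par_MuE:
  assumes "par b (Mu e) v"
  obtains (mu) e' where "v = Mu e'" "par b e e'"
    | (unfold) e' where "v = inst_ev (Mu e') e'" "b" "par b e e'"
  using assms by (cases rule: par.cases) blast+

lemma par_refl [simp, intro]: "par b e e"
  by (induction e) (auto intro: par.intros)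

lemma par_subst_ev_ty:
  "par b e e' \<Longrightarrow> (\<And>i. par_ty (\<sigma> i) (\<sigma>' i)) \<Longrightarrow> par b (subst_ev_ty \<sigma> e) (subst_ev_ty \<sigma>' e')"
  by (induction arbitrary: \<sigma> \<sigma>' rule: par.induct)
    (auto simp: subst_inst_ev_ty subst_ev_ty_inst_ev intro!: par.intros par_ty_subst par_ty_up)

lemma par_ren_ev_ty: "par b e e' \<Longrightarrow> par b (ren_ev_ty \<rho> e) (ren_ev_ty \<rho> e')"
  by (simp add: ren_ev_ty_conv_subst par_subst_ev_ty)

lemma par_inst_ev_ty: "par b e e' \<Longrightarrow> par_ty T T' \<Longrightarrow> par b (inst_ev_ty T e) (inst_ev_ty T' e')"
  unfolding inst_ev_ty_def by (intro par_subst_ev_ty par_ty_case_nat)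

lemma par_ren_ev: "par b e e' \<Longrightarrow> par b (ren_ev \<rho> e) (ren_ev \<rho> e')"
  by (induction arbitrary: \<rho> rule: par.induct)
    (auto simp: ren_inst_ev ren_ev_inst_ev_ty intro: par.intros)

lemma par_up_ev: "(\<And>i. par b (\<theta> i) (\<theta>' i)) \<Longrightarrow> par b (up_ev \<theta> i) (up_ev \<theta>' i)"
  by (cases i) (auto intro: par_ren_ev)

text \<open>Images are weakened in their evidence variables under \<open>Lam\<close> and
  \<open>Mu\<close>, and in their type variables under \<open>TLam\<close>; \<open>par_up_ev\<close>
  and \<open>par_ren_ev_ty\<close> keep them related in these cases.\<close>

lemma par_subst_ev:
  "par b e e' \<Longrightarrow> (\<And>i. par b (\<theta> i) (\<theta>' i)) \<Longrightarrow> par b (subst_ev \<theta> e) (subst_ev \<theta>' e')"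
proof (induction arbitrary: \<theta> \<theta>' rule: par.induct)
  case (tau e e' T T')
  then show ?case by (simp add: subst_ev_inst_ev_ty par.tau par_ren_ev_ty)
next
  case (beta e e' d d')
  then show ?case by (simp add: subst_inst_ev par.beta par_up_ev)
next
  case (unfold e e')
  then show ?case by (simp add: subst_inst_ev par.unfold par_up_ev)
next
  case (tapp e e' T T')
  then show ?case by (simp add: par.tapp)
qed (simp_all add: par.lam par.app par.mu par.tlam par_up_ev par_ren_ev_ty)

lemma par_inst_ev:
  assumes "par b e e'" "par b d d'"
  shows "par b (inst_ev d e) (inst_ev d' e')"
proof -
  have "par b (case_nat d Var i) (case_nat d' Var i)" for i
    using assms by (cases i) auto
  then show ?thesis unfolding inst_ev_def using assms by (intro par_subst_ev)
qed

lemma par_diamond: "par b e u \<Longrightarrow> par b e v \<Longrightarrow> \<exists>w. par b u w \<and> par b v w"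
proof (induction arbitrary: v rule: par.induct)
  case (lam e e')
  from lam.prems show ?case by (rule par_LamE) (metis lam.IH par.lam)
next
  case (tlam e e')
  from tlam.prems show ?case by (rule par_TLamE) (metis tlam.IH par.tlam)
next
  case (app e e' d d')
  from app.prems show ?case
  proof (rule par_AppE)
    fix e2 d2 assume "v = App e2 d2" "par b e e2" "par b d d2"
    then show ?case by (metis app.IH par.app)
  next
    fix f f2 d2 assume *: "e = Lam f" "v = inst_ev d2 f2" "b" "par b f f2" "par b d d2"
    from * app.hyps obtain f1 where f1: "e' = Lam f1" by (auto elim: par_LamE)
    \<comment> \<open>As for types, the step in the body is lifted under \<open>Lam\<close> to fit
      the induction hypothesis.\<close>
    obtain w where "par b (Lam f1) w" "par b (Lam f2) w"
      using app.IH(1)[of "Lam f2"] * f1 by (auto intro: par.lam)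
    then obtain f3 where "par b f1 f3" "par b f2 f3" by (auto elim!: par_LamE)
    moreover obtain d3 where "par b d' d3" "par b d2 d3" using app.IH(2) * by blast
    ultimately show ?case using * f1 by (blast intro: par.beta par_inst_ev)
  qed
next
  case (mu e e')
  from mu.prems show ?case
  proof (rule par_MuE)
    fix e2 assume "v = Mu e2" "par b e e2"
    then show ?case using mu.IH by (blast intro: par.mu)
  next
    fix e2 assume *: "v = inst_ev (Mu e2) e2" "b" "par b e e2"
    then obtain w where "par b e' w" "par b e2 w" using mu.IH by blast
    \<comment> \<open>The common reduct is \<open>inst_ev (Mu w) w\<close>: one side unfolds, the
      other reduces the body and the inserted copy of the fixed point simultaneously.\<close>
    with * show ?case by (blast intro: par.unfold par.mu par_inst_ev)
  qed
next
  case (tapp e e' T T')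
  from tapp.prems show ?case
  proof (rule par_TAppE)
    fix e2 T2 assume "v = TApp e2 T2" "par b e e2" "par_ty T T2"
    then show ?case by (metis tapp.IH tapp.hyps(2) par_ty_diamond par.tapp)
  next
    fix f f2 T2 assume *: "e = TLam f" "v = inst_ev_ty T2 f2" "par b f f2" "par_ty T T2"
    from * tapp.hyps obtain f1 where f1: "e' = TLam f1" by (auto elim: par_TLamE)
    obtain w where "par b (TLam f1) w" "par b (TLam f2) w"
      using tapp.IH(1)[of "TLam f2"] * f1 by (auto intro: par.tlam)
    then obtain f3 where "par b f1 f3" "par b f2 f3" by (auto elim!: par_TLamE)
    moreover obtain T3 where "par_ty T' T3" "par_ty T2 T3"
      using par_ty_diamond tapp.hyps(2) * by blast
    ultimately show ?case using * f1 by (blast intro: par.tau par_inst_ev_ty)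
  qed
next
  case (tau e e' T T')
  from tau.prems show ?case
  proof (rule par_TAppE)
    fix f T2 assume *: "v = TApp f T2" "par b (TLam e) f" "par_ty T T2"
    then obtain e2 where e2: "f = TLam e2" "par b e e2" by (auto elim: par_TLamE)
    obtain e3 T3 where "par b e' e3" "par b e2 e3" "par_ty T' T3" "par_ty T2 T3"
      using tau.IH par_ty_diamond tau.hyps(2) * e2 by blast
    with * e2 show ?case by (blast intro: par.tau par_inst_ev_ty)
  next
    fix f f2 T2 assume *: "TLam e = TLam f" "v = inst_ev_ty T2 f2" "par b f f2" "par_ty T T2"
    then obtain e3 T3 where "par b e' e3" "par b f2 e3" "par_ty T' T3" "par_ty T2 T3"
      using tau.IH par_ty_diamond tau.hyps(2) by blast
    with * show ?case by (blast intro: par_inst_ev_ty)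
  qed
next
  case (beta e e' d d')
  from beta.prems show ?case
  proof (rule par_AppE)
    fix f d2 assume *: "v = App f d2" "par b (Lam e) f" "par b d d2"
    then obtain e2 where e2: "f = Lam e2" "par b e e2" by (auto elim: par_LamE)
    obtain e3 d3 where "par b e' e3" "par b e2 e3" "par b d' d3" "par b d2 d3"
      using beta.IH * e2 by blast
    with * e2 beta.hyps(1) show ?case by (blast intro: par.beta par_inst_ev)
  next
    fix f f2 d2 assume *: "Lam e = Lam f" "v = inst_ev d2 f2" "par b f f2" "par b d d2"
    then obtain e3 d3 where "par b e' e3" "par b f2 e3" "par b d' d3" "par b d2 d3"
      using beta.IH by blast
    with * show ?case by (blast intro: par_inst_ev)
  qed
next
  case (unfold e e')
  from unfold.prems show ?case
  proof (rule par_MuE)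
    fix e2 assume *: "v = Mu e2" "par b e e2"
    then obtain w where "par b e' w" "par b e2 w" using unfold.IH by blast
    with * unfold.hyps(1) show ?case by (blast intro: par.unfold par.mu par_inst_ev)
  next
    fix e2 assume *: "v = inst_ev (Mu e2) e2" "par b e e2"
    then obtain w where "par b e' w" "par b e2 w" using unfold.IH by blast
    with * show ?case by (blast intro: par.mu par_inst_ev)
  qed
qed (auto elim: par_VarE par_ConstE)


section \<open>Parallel reduction versus reduction in contexts\<close>

definition compatible :: "(('c, 'f, 'k) ev \<Rightarrow> ('c, 'f, 'k) ev \<Rightarrow> bool) \<Rightarrow> bool" where
  "compatible r \<longleftrightarrow> (\<forall>C e e'. r e e' \<longrightarrow> r (fill C e) (fill C e'))"

text \<open>Composition of contexts. As \<open>D\<close> is chosen before \<open>e\<close>, it fits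
  redex and contractum alike, which yields compatibility of each relation.\<close>

lemma fill_fill: "\<exists>D. \<forall>e. fill C (fill C' e) = fill D e"
  by (induction C) (metis fill.simps)+

lemma compatible_red_tau: "compatible red_tau"
  unfolding compatible_def by (metis fill_fill red_tau.simps)

lemma compatible_red_mu: "compatible red_mu"
  unfolding compatible_def by (metis fill_fill red_mu.simps)

lemma compatible_red_beta: "compatible red_beta"
  unfolding compatible_def by (metis fill_fill red_beta.simps)

lemma compatible_red_o: "compatible red_o"
  unfolding compatible_def by (metis fill_fill red_o.simps)

lemma compatible_rtranclp:
  assumes "compatible r"
  shows "compatible r\<^sup>*\<^sup>*"
proof -
  have "r\<^sup>*\<^sup>* e e' \<Longrightarrow> r\<^sup>*\<^sup>* (fill C e) (fill C e')" for C e e'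
    by (induction rule: rtranclp_induct)
      (auto intro: rtranclp.rtrancl_into_rtrancl assms[unfolded compatible_def, rule_format])
  then show ?thesis by (simp add: compatible_def)
qed

lemma rtranclp_context:
  assumes "compatible r"
  shows "r\<^sup>*\<^sup>* e e' \<Longrightarrow> r\<^sup>*\<^sup>* (Lam e) (Lam e')"
    and "r\<^sup>*\<^sup>* e e' \<Longrightarrow> r\<^sup>*\<^sup>* (Mu e) (Mu e')"
    and "r\<^sup>*\<^sup>* e e' \<Longrightarrow> r\<^sup>*\<^sup>* (TLam e) (TLam e')"
    and "r\<^sup>*\<^sup>* e e' \<Longrightarrow> r\<^sup>*\<^sup>* (TApp e T) (TApp e' T)"
    and "r\<^sup>*\<^sup>* e e' \<Longrightarrow> r\<^sup>*\<^sup>* d d' \<Longrightarrow> r\<^sup>*\<^sup>* (App e d) (App e' d')"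
proof -
  have *: "r\<^sup>*\<^sup>* e e' \<Longrightarrow> r\<^sup>*\<^sup>* (fill C e) (fill C e')" for C e e'
    using compatible_rtranclp[OF assms] by (simp add: compatible_def)
  show "r\<^sup>*\<^sup>* e e' \<Longrightarrow> r\<^sup>*\<^sup>* (Lam e) (Lam e')" using *[of e e' "CLam Hole"] by simp
  show "r\<^sup>*\<^sup>* e e' \<Longrightarrow> r\<^sup>*\<^sup>* (Mu e) (Mu e')" using *[of e e' "CMu Hole"] by simp
  show "r\<^sup>*\<^sup>* e e' \<Longrightarrow> r\<^sup>*\<^sup>* (TLam e) (TLam e')" using *[of e e' "CTLam Hole"] by simp
  show "r\<^sup>*\<^sup>* e e' \<Longrightarrow> r\<^sup>*\<^sup>* (TApp e T) (TApp e' T)" using *[of e e' "CTApp Hole T"] by simp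
  show "r\<^sup>*\<^sup>* e e' \<Longrightarrow> r\<^sup>*\<^sup>* d d' \<Longrightarrow> r\<^sup>*\<^sup>* (App e d) (App e' d')"
    using *[of e e' "CAppL Hole d"] *[of d d' "CAppR e' Hole"] by simp
qed

text \<open>Source and target relation may live on different types, so reductions of a type can be
  carried into the argument of \<open>TApp\<close>.\<close>

lemma rtranclp_map:
  "r\<^sup>*\<^sup>* x y \<Longrightarrow> (\<And>x y. r x y \<Longrightarrow> s\<^sup>*\<^sup>* (f x) (f y)) \<Longrightarrow> s\<^sup>*\<^sup>* (f x) (f y)"
  by (induction rule: rtranclp_induct) (auto intro: rtranclp_trans)

text \<open>A parallel step is sequentialized by reducing the components first and contracting the
  root redex last.\<close>

lemma par_ty_imp_red_ty: "par_ty T T' \<Longrightarrow> red_ty\<^sup>*\<^sup>* T T'"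
proof (induction rule: par_ty.induct)
  case (lam T T')
  from lam.IH show ?case by (rule rtranclp_map) (blast intro: red_ty.lam)
next
  case (all T T' K)
  from all.IH show ?case by (rule rtranclp_map) (blast intro: red_ty.all)
next
  case (app T T' U U')
  have "red_ty\<^sup>*\<^sup>* (TyApp T U) (TyApp T' U)"
    using app.IH(1) by (rule rtranclp_map) (blast intro: red_ty.appL)
  also have "red_ty\<^sup>*\<^sup>* (TyApp T' U) (TyApp T' U')"
    using app.IH(2) by (rule rtranclp_map) (blast intro: red_ty.appR)
  finally show ?case .
next
  case (imp T T' U U')
  have "red_ty\<^sup>*\<^sup>* (TyImp T U) (TyImp T' U)"
    using imp.IH(1) by (rule rtranclp_map) (blast intro: red_ty.impL)
  also have "red_ty\<^sup>*\<^sup>* (TyImp T' U) (TyImp T' U')"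
    using imp.IH(2) by (rule rtranclp_map) (blast intro: red_ty.impR)
  finally show ?case .
next
  case (beta T T' U U')
  have "red_ty\<^sup>*\<^sup>* (TyApp (TyLam T) U) (TyApp (TyLam T') U)"
    using beta.IH(1) by (rule rtranclp_map) (blast intro: red_ty.appL red_ty.lam)
  also have "red_ty\<^sup>*\<^sup>* (TyApp (TyLam T') U) (TyApp (TyLam T') U')"
    using beta.IH(2) by (rule rtranclp_map) (blast intro: red_ty.appR)
  also have "red_ty (TyApp (TyLam T') U') (inst_ty U' T')" by (rule red_ty.beta)
  finally show ?case .
qed simp_all

lemma red_ty_imp_par_ty: "red_ty T T' \<Longrightarrow> par_ty T T'"
  by (induction rule: red_ty.induct) (auto intro: par_ty.intros)

lemma root_steps:
  "red_tau (TApp (TLam e) T) (inst_ev_ty T e)"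
  "red_mu (Mu e) (inst_ev (Mu e) e)"
  "red_beta (App (Lam e) d) (inst_ev d e)"
  "red_ty T T' \<Longrightarrow> red_o (TApp e T) (TApp e T')"
  using red_tau.intros[of Hole] red_mu.intros[of Hole] red_beta.intros[of Hole]
    red_o.intros[of T T' Hole] by simp_all

text \<open>Single-step counterpart of \<open>par b\<close>, governed by the same flag.\<close>

definition step :: "bool \<Rightarrow> ('c, 'f, 'k) ev \<Rightarrow> ('c, 'f, 'k) ev \<Rightarrow> bool" where
  "step b e e' \<longleftrightarrow> red_tau e e' \<or> red_o e e' \<or> b \<and> (red_beta e e' \<or> red_mu e e')"

lemma compatible_step: "compatible (step b)"
  using compatible_red_tau compatible_red_o compatible_red_beta compatible_red_mu
  unfolding compatible_def step_def by blast

text \<open>Sequentialization as for types. Reductions of a type argument become o steps; in the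
  beta and mu cases the premise \<open>b\<close> licenses the final contraction.\<close>

lemma par_imp_steps: "par b e e' \<Longrightarrow> (step b)\<^sup>*\<^sup>* e e'"
proof (induction rule: par.induct)
  case (tapp e e' T T')
  have "(step b)\<^sup>*\<^sup>* (TApp e T) (TApp e' T)"
    by (rule rtranclp_context(4)[OF compatible_step tapp.IH])
  also have "(step b)\<^sup>*\<^sup>* (TApp e' T) (TApp e' T')"
    using par_ty_imp_red_ty[OF tapp.hyps(2)]
    by (rule rtranclp_map) (auto simp: step_def intro: root_steps)
  finally show ?case .
next
  case (tau e e' T T')
  have "(step b)\<^sup>*\<^sup>* (TApp (TLam e) T) (TApp (TLam e') T)"
    by (intro rtranclp_context[OF compatible_step] tau.IH)
  also have "(step b)\<^sup>*\<^sup>* (TApp (TLam e') T) (TApp (TLam e') T')"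
    using par_ty_imp_red_ty[OF tau.hyps(2)]
    by (rule rtranclp_map) (auto simp: step_def intro: root_steps)
  also have "step b (TApp (TLam e') T') (inst_ev_ty T' e')" by (simp add: step_def root_steps)
  finally show ?case .
next
  case (beta e e' d d')
  have "(step b)\<^sup>*\<^sup>* (App (Lam e) d) (App (Lam e') d')"
    by (intro rtranclp_context[OF compatible_step] beta.IH)
  also have "step b (App (Lam e') d') (inst_ev d' e')"
    using beta.hyps(1) by (simp add: step_def root_steps)
  finally show ?case .
next
  case (unfold e e')
  have "(step b)\<^sup>*\<^sup>* (Mu e) (Mu e')"
    by (intro rtranclp_context[OF compatible_step] unfold.IH)
  also have "step b (Mu e') (inst_ev (Mu e') e')"
    using unfold.hyps(1) by (simp add: step_def root_steps)
  finally show ?case .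
qed (auto intro: rtranclp_context[OF compatible_step])

lemma par_fill: "par b e e' \<Longrightarrow> par b (fill C e) (fill C e')"
  by (induction C) (auto intro: par.intros)

lemma step_imp_par: "step b e e' \<Longrightarrow> par b e e'"
  unfolding step_def
  by (auto elim!: red_tau.cases red_o.cases red_beta.cases red_mu.cases
      intro!: par_fill par.tau par.tapp par.beta par.unfold dest: red_ty_imp_par_ty)

lemma diamond_imp_confluentp:
  assumes "r \<le> p" "p \<le> r\<^sup>*\<^sup>*"
    and diamond: "\<And>x y z. p x y \<Longrightarrow> p x z \<Longrightarrow> \<exists>w. p y w \<and> p z w"
  shows "confluentp r"
proof -
  have "strong_confluentp p"
    using diamond by (intro strong_confluentpI) blast
  then have "confluentp p" by (rule strong_confluentp_imp_confluentp)
  moreover have "p\<^sup>*\<^sup>* = r\<^sup>*\<^sup>*"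
    using assms(1,2) by (metis rtranclp_subset)
  \<comment> \<open>Moving the converse outside the closure exhibits confluence as a property of the
    reflexive transitive closure alone, so it transfers from \<open>p\<close> to
    \<open>r\<close>.\<close>
  ultimately show ?thesis by (simp add: confluentp_def rtranclp_conversep)
qed


section \<open>Head reduction\<close>

text \<open>Head reduction with congruence rules in place of contexts, which permits rule induction
  and inversion.\<close>

inductive hstep :: "('c, 'f, 'k) ev \<Rightarrow> ('c, 'f, 'k) ev \<Rightarrow> bool" where
  unfold: "hstep (Mu e) (inst_ev (Mu e) e)"
| beta: "hstep (App (Lam e) d) (inst_ev d e)"
| app: "hstep e e' \<Longrightarrow> hstep (App e d) (App e' d)"
| lam: "hstep e e' \<Longrightarrow> hstep (Lam e) (Lam e')"
| tlam: "hstep e e' \<Longrightarrow> hstep (TLam e) (TLam e')"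

inductive_cases hstep_MuE: "hstep (Mu e) u"
inductive_cases hstep_AppE: "hstep (App e d) u"
inductive_cases hstep_LamE: "hstep (Lam e) u"
inductive_cases hstep_TLamE: "hstep (TLam e) u"

lemma red_h_eq_hstep: "(red_h :: ('c, 'f, 'k) ev \<Rightarrow> ('c, 'f, 'k) ev \<Rightarrow> bool) = hstep"
proof (intro ext iffI)
  fix e e' :: "('c, 'f, 'k) ev"
  have *: "hstep u v \<Longrightarrow> hstep (hfill H u) (hfill H v)" for H and u v :: "('c, 'f, 'k) ev"
    by (induction H) (auto intro: hstep.intros)
  show "red_h e e' \<Longrightarrow> hstep e e'"
    by (auto elim!: red_h.cases intro: * hstep.intros)
next
  fix e e' :: "('c, 'f, 'k) ev"
  assume "hstep e e'"
  then show "red_h e e'"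
  proof (induction rule: hstep.induct)
    case (unfold e)
    show ?case using red_h.mu[of HHole] by simp
  next
    case (beta e d)
    show ?case using red_h.beta[of HHole] by simp
  next
    case (app e e' d)
    from app.IH show ?case
    proof cases
      case (mu H f)
      then show ?thesis using red_h.mu[of "HApp H d" f] by simp
    next
      case (beta H f g)
      then show ?thesis using red_h.beta[of "HApp H d" f g] by simp
    qed
  next
    case (lam e e')
    from lam.IH show ?case
    proof cases
      case (mu H f)
      then show ?thesis using red_h.mu[of "HLam H" f] by simp
    next
      case (beta H f g)
      then show ?thesis using red_h.beta[of "HLam H" f g] by simp
    qed
  next
    case (tlam e e')
    from tlam.IH show ?case
    proof cases
      case (mu H f)
      then show ?thesis using red_h.mu[of "HTLam H" f] by simp
    next
      case (beta H f g)
      then show ?thesis using red_h.beta[of "HTLam H" f g] by simp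
    qed
  qed
qed

text \<open>A variable is never the root of a redex and substitution commutes with instantiation, so
  head redexes and their contracta survive.\<close>

lemma hstep_subst_ev: "hstep e e' \<Longrightarrow> hstep (subst_ev \<theta> e) (subst_ev \<theta> e')"
proof (induction arbitrary: \<theta> rule: hstep.induct)
  case (unfold e)
  show ?case using hstep.unfold by (simp add: subst_inst_ev)
qed (auto simp: subst_inst_ev intro: hstep.intros)

lemma hstep_inst_ev: "hstep e e' \<Longrightarrow> hstep (inst_ev d e) (inst_ev d e')"
  by (simp add: inst_ev_def hstep_subst_ev)

text \<open>The only overlap is a beta redex against a head step in the body of its abstraction,
  closed by \<open>hstep_inst_ev\<close>. Arguments and bodies of \<open>Mu\<close> admit no head
  step, so copying them causes no further work.\<close>

lemma hstep_diamond: "hstep e u \<Longrightarrow> hstep e v \<Longrightarrow> u = v \<or> (\<exists>w. hstep u w \<and> hstep v w)"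
proof (induction arbitrary: v rule: hstep.induct)
  case (unfold e)
  then show ?case by (auto elim: hstep_MuE)
next
  case (beta e d)
  then show ?case
    by (elim hstep_AppE) (auto elim!: hstep_LamE intro: hstep.beta hstep_inst_ev)
next
  case (app e e' d)
  from app.prems show ?case
  proof (rule hstep_AppE)
    fix f assume "e = Lam f" "v = inst_ev d f"
    with app.hyps show ?case by (auto elim!: hstep_LamE intro: hstep.beta hstep_inst_ev)
  next
    fix e2 assume "v = App e2 d" "hstep e e2"
    with app.IH show ?case by (blast intro: hstep.app)
  qed
next
  case (lam e e')
  from lam.prems obtain e2 where "v = Lam e2" "hstep e e2" by (auto elim: hstep_LamE)
  with lam.IH show ?case by (blast intro: hstep.lam)
next
  case (tlam e e')
  from tlam.prems obtain e2 where "v = TLam e2" "hstep e e2" by (auto elim: hstep_TLamE)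
  with tlam.IH show ?case by (blast intro: hstep.tlam)
qed

text \<open>With the flag off, only \<open>TApp\<close> can lose its root constructor. Along a head
  position there is no \<open>TApp\<close>, so the redex keeps its shape and place and a single head
  step closes the square.\<close>

lemma hstep_par_commute: "hstep e u \<Longrightarrow> par False e v \<Longrightarrow> \<exists>w. par False u w \<and> hstep v w"
proof (induction arbitrary: v rule: hstep.induct)
  case (unfold e)
  then show ?case by (auto elim!: par_MuE intro: par_inst_ev par.mu hstep.unfold)
next
  case (beta e d)
  then show ?case by (auto elim!: par_AppE par_LamE intro: par_inst_ev hstep.beta)
next
  case (app e e' d)
  from app.prems obtain e2 d2 where "v = App e2 d2" "par False e e2" "par False d d2"
    by (auto elim: par_AppE)
  with app.IH show ?case by (blast intro: par.app hstep.app)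
next
  case (lam e e')
  from lam.prems obtain e2 where "v = Lam e2" "par False e e2" by (auto elim: par_LamE)
  with lam.IH show ?case by (blast intro: par.lam hstep.lam)
next
  case (tlam e e')
  from tlam.prems obtain e2 where "v = TLam e2" "par False e e2" by (auto elim: par_TLamE)
  with tlam.IH show ?case by (blast intro: par.tlam hstep.tlam)
qed

section \<open>The two confluence results\<close>

lemma confluentp_red_beta_mu_tau_o: "confluentp red_beta_mu_tau_o"
proof -
  have eq: "red_beta_mu_tau_o = step True"
    by (intro ext) (auto simp: red_beta_mu_tau_o_def step_def)
  show ?thesis unfolding eq
  proof (rule diamond_imp_confluentp)
    show "step True \<le> par True" by (auto intro: step_imp_par)
    show "par True \<le> (step True)\<^sup>*\<^sup>*" by (auto intro: par_imp_steps)
  qed (rule par_diamond)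
qed

lemma confluentp_red_h_tau_o: 
  "confluentp (red_h_tau_o :: ('c, 'f, 'k) ev \<Rightarrow> ('c, 'f, 'k) ev \<Rightarrow> bool)"
proof (rule diamond_imp_confluentp)
  show "red_h_tau_o \<le> sup hstep (par False)"
    by (auto simp: red_h_tau_o_def red_h_eq_hstep step_def intro: step_imp_par)
  have "step False \<le> red_h_tau_o" by (auto simp: red_h_tau_o_def step_def)
  then have "(step False)\<^sup>*\<^sup>* \<le> red_h_tau_o\<^sup>*\<^sup>*" by (rule rtranclp_mono)
  then show "sup hstep (par False) \<le> red_h_tau_o\<^sup>*\<^sup>*"
    by (auto simp: red_h_tau_o_def red_h_eq_hstep dest: par_imp_steps)
next
  fix x y z :: "('c, 'f, 'k) ev"
  assume "sup hstep (par False) x y" "sup hstep (par False) x z"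
  then show "\<exists>w. sup hstep (par False) y w \<and> sup hstep (par False) z w"
    \<comment> \<open>One fact per combination of steps, with the commutation used in both
      orientations; when two head steps coincide, reflexivity of \<open>par False\<close> gives the
      join.\<close>
    using hstep_diamond[of x y z] hstep_par_commute[of x y z] hstep_par_commute[of x z y]
      par_diamond[of False x y z] par_refl[of False y]
    unfolding sup_apply sup_bool_def by blast
qed


section \<open>Termination of type application\<close>

text \<open>Type arguments count for nothing, so the measure is invariant under type substitution
  however often the argument is copied.\<close>

primrec tlams :: "('c, 'f, 'k) ev \<Rightarrow> nat" where
  "tlams (Var i) = 0"
| "tlams (Const c) = 0"
| "tlams (Lam e) = tlams e"
| "tlams (App e e') = tlams e + tlams e'"
| "tlams (Mu e) = tlams e"
| "tlams (TApp e T) = tlams e"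
| "tlams (TLam e) = Suc (tlams e)"

lemma tlams_subst_ev_ty: "tlams (subst_ev_ty \<sigma> e) = tlams e"
  by (induction e arbitrary: \<sigma>) simp_all

lemma tlams_fill_less: "tlams e < tlams e' \<Longrightarrow> tlams (fill C e) < tlams (fill C e')"
  by (induction C) simp_all

lemma strongly_normalizing_red_tau: 
  "strongly_normalizing (red_tau :: ('c, 'f, 'k) ev \<Rightarrow> ('c, 'f, 'k) ev \<Rightarrow> bool)"
proof -
  have less: "tlams e' < tlams e" if "red_tau e e'" for e e' :: "('c, 'f, 'k) ev"
    using that
    by cases (auto intro: tlams_fill_less simp: inst_ev_ty_def tlams_subst_ev_ty)
  show ?thesis
    unfolding strongly_normalizing_def 
    by (rule wfp_if_convertible_to_nat[of _ tlams]) (auto intro: less)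
qed

theorem theorem11:
  shows "confluentp (red_beta_mu_tau_o :: ('c, 'f, 'k) ev \<Rightarrow> ('c, 'f, 'k) ev \<Rightarrow> bool)
       \<and> confluentp (red_h_tau_o :: ('c, 'f, 'k) ev \<Rightarrow> ('c, 'f, 'k) ev \<Rightarrow> bool)
       \<and> strongly_normalizing (red_tau :: ('c, 'f, 'k) ev \<Rightarrow> ('c, 'f, 'k) ev \<Rightarrow> bool)"
  using confluentp_red_beta_mu_tau_o confluentp_red_h_tau_o strongly_normalizing_red_tau by blast

end
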